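(* Let $X$ be a nonempty set and let $F\colon X^2\to X$ be a bisymmetric operation. Then $F$ is $(1,2)$-selective if and only if the following two conditions hold. (i) $F(x,y)=F(x,z)$ for all $x,y,z\in X$. (ii) $F|_{\mathrm{ran}(F)\times X}=\pi_1|_{\mathrm{ran}(F)\times X}$, that is, $F(x,y)=x$ for all $x\in\mathrm{ran}(F)$ and $y\in X$.
   Context: An operation $F\colon X^2\to X$ is $(1,2)$-selective if $F(F(x_1,x_2),F(x_3,x_4))=F(x_1,x_2)$ for all $x_1,x_2,x_3,x_4\in X$, and bisymmetric if $F(F(x,y),F(u,v))=F(F(x,u),F(y,v))$ for all $x,y,u,v\in X$. $\mathrm{ran}(F)$ denotes the range of $F$, and $\pi_1(x,y)=x$ is the first projection. *)

theory Defs
  imports Main "HOL-Library.FuncSet"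
begin

(* An operation on the set X is a function on pairs mapping X \<times> X into X; its values
   outside X \<times> X are irrelevant, so every notion below is relativised to X. *)

definition selective_1_2 :: "'a set \<Rightarrow> ('a \<times> 'a \<Rightarrow> 'a) \<Rightarrow> bool" where
  "selective_1_2 X F \<longleftrightarrow>
     (\<forall>x1\<in>X. \<forall>x2\<in>X. \<forall>x3\<in>X. \<forall>x4\<in>X. F (F (x1, x2), F (x3, x4)) = F (x1, x2))"

definition bisymmetric :: "'a set \<Rightarrow> ('a \<times> 'a \<Rightarrow> 'a) \<Rightarrow> bool" where
  "bisymmetric X F \<longleftrightarrow>
     (\<forall>x\<in>X. \<forall>y\<in>X. \<forall>u\<in>X. \<forall>v\<in>X. F (F (x, y), F (u, v)) = F (F (x, u), F (y, v)))"

definition ran_on :: "'a set \<Rightarrow> ('a \<times> 'a \<Rightarrow> 'a) \<Rightarrow> 'a set" where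
  "ran_on X F = F ` (X \<times> X)"

end

theory Submission
  imports Defs
begin

text \<open>Selectivity lets one append an outer argument \<open>F (z, z)\<close> to
  \<open>F (x, y)\<close>; bisymmetry then exchanges the inner \<open>y\<close> and
  \<open>z\<close>, and selectivity drops the new outer argument, leaving \<open>F (x, z)\<close>.
  So \<open>F\<close> ignores its second argument, and selectivity, which only speaks of second
  arguments in the range, extends to all of \<open>X\<close>: this is (ii).\<close>

theorem proposition5p2:
  fixes X :: "'a set" and F :: "'a \<times> 'a \<Rightarrow> 'a"
  assumes "X \<noteq> {}"
    and "F \<in> X \<times> X \<rightarrow> X"
    and "bisymmetric X F"
  shows "selective_1_2 X F \<longleftrightarrow>
    (\<forall>x\<in>X. \<forall>y\<in>X. \<forall>z\<in>X. F (x, y) = F (x, z)) \<and>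
    restrict F (ran_on X F \<times> X) = restrict fst (ran_on X F \<times> X)"
proof -
  have closed: "F (x, y) \<in> X" if "x \<in> X" "y \<in> X" for x y
    using assms(2) that by blast
  \<comment> \<open>Both restrictions are \<open>undefined\<close> off the common domain, so their
    equality is pointwise agreement there; points of the range are written
    \<open>F (a, b)\<close>.\<close>
  have restrict_iff: "restrict F (ran_on X F \<times> X) = restrict fst (ran_on X F \<times> X) \<longleftrightarrow>
      (\<forall>a\<in>X. \<forall>b\<in>X. \<forall>y\<in>X. F (F (a, b), y) = F (a, b))"
    by (auto simp: restrict_def ran_on_def fun_eq_iff)
  show ?thesis
    unfolding restrict_iff
  proof (intro iffI conjI ballI)
    assume "selective_1_2 X F"
    then have sel: "F (F (a, b), F (c, d)) = F (a, b)"
      if "a \<in> X" "b \<in> X" "c \<in> X" "d \<in> X" for a b c d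
      using that by (simp add: selective_1_2_def)
    show first_only: "F (x, y) = F (x, z)" if "x \<in> X" "y \<in> X" "z \<in> X" for x y z
    proof -
      have "F (x, y) = F (F (x, y), F (z, z))"
        using that by (simp add: sel)
      also have "\<dots> = F (F (x, z), F (y, z))"
        using assms(3) that unfolding bisymmetric_def by blast
      also have "\<dots> = F (x, z)"
        using that by (simp add: sel)
      finally show ?thesis .
    qed
    show "F (F (a, b), y) = F (a, b)" if "a \<in> X" "b \<in> X" "y \<in> X" for a b y
    proof -
      \<comment> \<open>\<open>y\<close> may lie outside the range; \<open>F (y, y)\<close> is a
        stand-in inside it, to which \<open>sel\<close> applies.\<close>
      have "F (F (a, b), y) = F (F (a, b), F (y, y))"
        using that by (intro first_only closed)
      also have "\<dots> = F (a, b)"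
        using that by (simp add: sel)
      finally show ?thesis .
    qed
  next
    assume "(\<forall>x\<in>X. \<forall>y\<in>X. \<forall>z\<in>X. F (x, y) = F (x, z)) \<and>
      (\<forall>a\<in>X. \<forall>b\<in>X. \<forall>y\<in>X. F (F (a, b), y) = F (a, b))"
    \<comment> \<open>Take \<open>F (x3, x4)\<close>, in \<open>X\<close> by closure, as the second
      argument in (ii).\<close>
    then show "selective_1_2 X F"
      unfolding selective_1_2_def using closed by blast
  qed
qed

end
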